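(* Let $(X,\mathcal{T})$ be a topological space, let $\mathcal{P}$ be a subbase for $\mathcal{T}$, and let $\mathcal{M}$ be a non-empty family with $\mathcal{M}\subseteq\{X\setminus U\mid U\in\mathcal{P}\}$, $\emptyset\notin\mathcal{M}$ and $X\in\mathcal{M}$. Let $\mathcal{O}=\mathcal{O}_{\mathcal{P}}^{\mathcal{M}}$. If $\mathcal{M}$ is closed under intersections of decreasing subfamilies, then $(\mathcal{M},\mathcal{O})$ has the fixed-point property.
   Context: For a family $\mathcal{M}$ of non-empty subsets of $X$ and $A\subseteq X$, put $A_{\mathcal{M}}^-=\{M\in\mathcal{M}\mid M\cap A\neq\emptyset\}$. For a family $\mathcal{S}$ of subsets of $X$ such that every $M\in\mathcal{M}$ meets $\bigcup\mathcal{S}$, $\mathcal{O}_{\mathcal{S}}^{\mathcal{M}}$ denotes the topology on $\mathcal{M}$ having $\{A_{\mathcal{M}}^-\mid A\in\mathcal{S}\}$ as a subbase. A subbase $\mathcal{P}$ for a topology on $X$ is a family of open sets whose finite (non-empty) intersections form a base; in particular $\bigcup\mathcal{P}=X$. "Closed under intersections of decreasing subfamilies" means that for every non-empty subfamily of $\mathcal{M}$ that is totally ordered by inclusion, its intersection belongs to $\mathcal{M}$. A space $Y$ has the fixed-point property if every continuous map $\Psi:Y\to Y$ has a point $y$ with $\Psi(y)=y$. *)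

theory Defs
  imports "HOL-Analysis.Analysis"
begin

text \<open>
  The finite intersections are taken over non-empty subfamilies, and not relative to the carrier,
  so a subbase covers the space. That the members of \<open>P\<close> are open follows from the equation.
\<close>

definition subbase_of :: "'a set set \<Rightarrow> 'a topology \<Rightarrow> bool" where
  "subbase_of P T \<longleftrightarrow>
     openin T = arbitrary union_of ((\<lambda>F. finite F \<and> F \<noteq> {}) intersection_of (\<lambda>U. U \<in> P))"

definition hit :: "'a set set \<Rightarrow> 'a set \<Rightarrow> 'a set set" where
  "hit M A = {B \<in> M. B \<inter> A \<noteq> {}}"

text \<open>The carrier of this topology is \<open>M\<close> only if every member of \<open>M\<close> meets \<open>\<Union>S\<close>.\<close>

definition hit_topology :: "'a set set \<Rightarrow> 'a set set \<Rightarrow> 'a set topology" where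
  "hit_topology M S = topology_generated_by (hit M ` S)"

definition closed_under_chain_Inter :: "'a set set \<Rightarrow> bool" where
  "closed_under_chain_Inter M \<longleftrightarrow> (\<forall>C \<subseteq> M. C \<noteq> {} \<and> chain_subset C \<longrightarrow> \<Inter>C \<in> M)"

definition fixed_point_property :: "'a topology \<Rightarrow> bool" where
  "fixed_point_property Y \<longleftrightarrow>
     (\<forall>\<Psi>. continuous_map Y Y \<Psi> \<longrightarrow> (\<exists>y \<in> topspace Y. \<Psi> y = y))"

lemma subbase_of_topology_generated_by: "subbase_of P (topology_generated_by P)"
proof -
  define B where "B = (\<lambda>F. finite F \<and> F \<noteq> {}) intersection_of (\<lambda>U. U \<in> P)"
  have B_iff: "B V \<longleftrightarrow> (\<exists>F. finite F \<and> F \<noteq> {} \<and> F \<subseteq> P \<and> \<Inter>F = V)" for V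
    by (simp add: B_def intersection_of_def)
  have Int: "B (V \<inter> W)" if VW: "B V" "B W" for V W
  proof -
    obtain F where F: "finite F" "F \<noteq> {}" "F \<subseteq> P" "\<Inter>F = V"
      using VW(1) unfolding B_iff by (elim exE conjE)
    obtain G where G: "finite G" "G \<subseteq> P" "\<Inter>G = W"
      using VW(2) unfolding B_iff by (elim exE conjE)
    have "finite (F \<union> G)" "F \<union> G \<noteq> {}" "F \<union> G \<subseteq> P" "\<Inter>(F \<union> G) = V \<inter> W"
      using F G by (simp_all add: Inter_Un_distrib)
    then show ?thesis
      unfolding B_iff by (intro exI conjI)
  qed
  define T where "T = topology (arbitrary union_of B)"
  have "istopology (arbitrary union_of B)"
    by (rule istopology_base) (rule Int)
  then have T: "openin T = arbitrary union_of B"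
    unfolding T_def by (rule topology_inverse')
  have gen_B: "generate_topology_on P V" if V: "B V" for V
  proof -
    obtain F where F: "finite F" "F \<noteq> {}" "F \<subseteq> P" "\<Inter>F = V"
      using V unfolding B_iff by (elim exE conjE)
    have "generate_topology_on P (\<Inter>F)"
      using F by (intro generate_topology_on_Inter) (auto intro: generate_topology_on.Basis)
    then show ?thesis
      using F by simp
  qed
  have gen: "generate_topology_on P W" if W: "openin T W" for W
  proof -
    obtain \<U> where U: "\<U> \<subseteq> Collect B" "\<Union>\<U> = W"
      using W unfolding T union_of_def by (elim exE conjE)
    have "generate_topology_on P (\<Union>\<U>)"
      by (rule generate_topology_on.UN) (use U gen_B in auto)
    then show ?thesis
      using U by simp
  qed
  have "openin T W" if "generate_topology_on P W" for W
    using that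
  proof induction
    case (Basis s)
    have "B s"
      unfolding B_iff using Basis by (intro exI[of _ "{s}"]) simp
    then show ?case
      unfolding T by (rule arbitrary_union_of_inc)
  qed (auto intro: openin_Union)
  with gen have "openin (topology_generated_by P) = openin T"
    unfolding fun_eq_iff openin_topology_generated_by_iff by blast
  then show ?thesis
    unfolding subbase_of_def T B_def .
qed

lemma subbase_of_iff: "subbase_of P T \<longleftrightarrow> T = topology_generated_by P"
  using subbase_of_topology_generated_by[of P]
  unfolding subbase_of_def by (metis openin_inverse)

lemma subbase_of_Union:
  assumes "subbase_of P T"
  shows "\<Union>P = topspace T"
  using assms by (simp add: subbase_of_iff)

lemma subbase_of_hit_topology: "subbase_of (hit M ` S) (hit_topology M S)"
  by (simp add: hit_topology_def subbase_of_topology_generated_by)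

lemma topspace_hit_topology:
  assumes "\<And>B. B \<in> M \<Longrightarrow> B \<inter> \<Union>S \<noteq> {}"
  shows "topspace (hit_topology M S) = M"
  using assms by (fastforce simp: hit_topology_def hit_def)

end

theory Submission
  imports Defs
begin

text \<open>
  The topology enters only through its specialization order, which is inclusion. An open set of a
  hit topology is closed under passing to larger members of the family, since a larger set hits
  whatever a smaller one does. Conversely, every member of \<open>M\<close> is the complement of some
  \<open>U \<in> P\<close>, so the subbasic open set of \<open>U\<close> separates it from each member of \<open>M\<close> that it does
  not contain. Continuous self-maps preserve the specialization order, hence are monotone
  (\<open>continuous_map_hit_topology_mono\<close>).

  What remains is order theory. The hypothesis on chains says that \<open>M\<close> is chain-complete
  downwards, and the whole space is a greatest element, hence a point that a self-map of \<open>M\<close>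
  moves downwards. Such a monotone map has a fixed point (\<open>chain_Inter_fixed_point\<close>).
\<close>

lemma openin_hit_topology_upward:
  assumes "openin (hit_topology M S) W" and "A \<in> W" and "A \<subseteq> B" and "B \<in> M"
  shows "B \<in> W"
proof -
  have "generate_topology_on (hit M ` S) W"
    using assms(1) by (simp add: hit_topology_def openin_topology_generated_by_iff)
  then show ?thesis
    using assms(2)
  proof induction
    case (Basis V)
    then show ?case
      using assms(3,4) by (auto simp: hit_def)
  qed auto
qed

text \<open>
  If \<open>f A\<close> were not below \<open>f B = X - U\<close>, the preimage of the subbasic open set of \<open>U\<close> would be an
  open set containing \<open>A\<close> but not the larger \<open>B\<close>.
\<close>

lemma continuous_map_hit_topology_mono:
  assumes cont: "continuous_map (hit_topology M S) (hit_topology M S) f"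
    and carrier: "topspace (hit_topology M S) = M"
    and compl: "M \<subseteq> {X - U | U. U \<in> S}"
    and AB: "A \<in> M" "B \<in> M" "A \<subseteq> B"
  shows "f A \<subseteq> f B"
proof -
  have maps: "f C \<in> M" if "C \<in> M" for C
    using continuous_map_funspace[OF cont] that unfolding carrier by auto
  obtain U where U: "U \<in> S" "f B = X - U"
    using compl maps[OF AB(2)] by auto
  have "openin (hit_topology M S) (hit M U)"
    using U(1) by (auto simp: hit_topology_def intro: topology_generated_by_Basis)
  then have preimage: "openin (hit_topology M S) {C \<in> M. f C \<in> hit M U}"
    using openin_continuous_map_preimage[OF cont] carrier by simp
  have "f A \<inter> U = {}"
  proof (rule ccontr)
    assume "f A \<inter> U \<noteq> {}"
    then have "A \<in> {C \<in> M. f C \<in> hit M U}"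
      using AB(1) maps by (auto simp: hit_def)
    then have "B \<in> {C \<in> M. f C \<in> hit M U}"
      using openin_hit_topology_upward[OF preimage] AB(2,3) by blast
    then show False
      using U(2) by (auto simp: hit_def)
  qed
  moreover have "f A \<subseteq> X"
    using compl maps[OF AB(1)] by auto
  ultimately show ?thesis
    using U(2) by blast
qed

text \<open>
  By monotonicity, the members that \<open>f\<close> moves downwards are closed under intersections of
  non-empty chains and mapped by \<open>f\<close> to members of the same kind; \<open>A\<^sub>0\<close> bounds the empty chain. So
  Zorn's lemma gives a minimal one, and minimality forces it to be fixed.
\<close>

lemma chain_Inter_fixed_point:
  assumes chain: "closed_under_chain_Inter M"
    and maps: "\<And>A. A \<in> M \<Longrightarrow> f A \<in> M"
    and mono: "\<And>A B. A \<in> M \<Longrightarrow> B \<in> M \<Longrightarrow> A \<subseteq> B \<Longrightarrow> f A \<subseteq> f B"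
    and start: "A\<^sub>0 \<in> M" "f A\<^sub>0 \<subseteq> A\<^sub>0"
  shows "\<exists>A\<in>M. f A = A"
proof -
  define D where "D = {A \<in> M. f A \<subseteq> A}"
  have "\<exists>m\<in>D. \<forall>A\<in>D. m \<supseteq> A \<longrightarrow> A = m"
  proof (rule predicate_Zorn)
    show "partial_order_on D (relation_of (\<supseteq>) D)"
      by (rule partial_order_on_relation_ofI) auto
  next
    fix C assume "C \<in> Chains (relation_of (\<supseteq>) D)"
    then have C: "C \<subseteq> D" "chain_subset C"
      by (auto simp: Chains_def relation_of_def chain_subset_def)
    show "\<exists>u\<in>D. \<forall>A\<in>C. A \<supseteq> u"
    proof (cases "C = {}")
      case True
      then show ?thesis
        using start by (auto simp: D_def)
    next
      case False
      have Inter: "\<Inter>C \<in> M"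
        using chain C False unfolding closed_under_chain_Inter_def D_def by blast
      have "f (\<Inter>C) \<subseteq> A" if "A \<in> C" for A
      proof -
        have "f (\<Inter>C) \<subseteq> f A"
          using C(1) that by (intro mono Inter) (auto simp: D_def)
        also have "\<dots> \<subseteq> A"
          using C(1) that by (auto simp: D_def)
        finally show ?thesis .
      qed
      then have "\<Inter>C \<in> D"
        using Inter by (auto simp: D_def)
      then show ?thesis
        by blast
    qed
  qed
  then obtain m where m: "m \<in> D" and minimal: "\<And>A. A \<in> D \<Longrightarrow> A \<subseteq> m \<Longrightarrow> A = m"
    by blast
  have "f m \<in> D"
    using m maps mono by (auto simp: D_def)
  then have "f m = m"
    using m minimal by (auto simp: D_def)
  then show ?thesis
    using m by (auto simp: D_def)
qed

theorem theorem5p5: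
  fixes T :: "'a topology" and P M :: "'a set set"
  assumes "subbase_of P T"
    and "M \<noteq> {}"
    and "M \<subseteq> {topspace T - U | U. U \<in> P}"
    and "{} \<notin> M"
    and "topspace T \<in> M"
    and "closed_under_chain_Inter M"
  shows "fixed_point_property (hit_topology M P)"
  unfolding fixed_point_property_def
proof (intro allI impI)
  fix f assume cont: "continuous_map (hit_topology M P) (hit_topology M P) f"
  have below: "B \<subseteq> topspace T" if "B \<in> M" for B
    using assms(3) that by auto
  have carrier: "topspace (hit_topology M P) = M"
  proof (rule topspace_hit_topology)
    fix B assume "B \<in> M"
    then show "B \<inter> \<Union>P \<noteq> {}"
      using below assms(4) subbase_of_Union[OF assms(1)] by (metis inf.absorb1)
  qed
  have maps: "f A \<in> M" if "A \<in> M" for A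
    using continuous_map_funspace[OF cont] that unfolding carrier by auto
  have "\<exists>A\<in>M. f A = A"
  proof (rule chain_Inter_fixed_point[OF assms(6)])
    show "f (topspace T) \<subseteq> topspace T"
      using below maps assms(5) by blast
  qed (use maps assms(5) continuous_map_hit_topology_mono[OF cont carrier assms(3)] in auto)
  then show "\<exists>y\<in>topspace (hit_topology M P). f y = y"
    unfolding carrier .
qed

end
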